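(* Let $m\ge 2$ and $k\ge 1$ be integers. Define polynomials $P_{k,j}(x)$ ($0\le j\le k$) and $Q_k(x)$ in $\mathbb{Z}[x]$ recursively by $P_{0,0}(x)=1$, $Q_0(x)=-1$, and for $k\ge 1$: \[ P_{k,0}(x)=x^{m^{k-1}-1}P_{k-1,0}(x),\qquad P_{k,k}(x)=-P_{k-1,k-1}(x),\qquad Q_k(x)=x^{m^{k-1}}Q_{k-1}(x), \] \[ P_{k,j}(x)=x^{m^{k-1}-m^{j}}P_{k-1,j}(x)-x^{m^{k-1}-m^{j-1}}P_{k-1,j-1}(x)\quad\text{for } j\in\{1,\ldots,k-1\}. \] Then the power series $A_m(k,x)$ satisfies \[ \sum_{j=0}^{k}P_{k,j}(x)A_m\big(k,x^{m^j}\big)+Q_k(x)=0. \]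
   Context: For integers $m\ge 2$, $k\ge 0$, $n\ge 0$, $a_m(k,n)$ denotes the number of partitions of $n$ into exactly $k$ parts, each a power of $m$, and $A_m(k,x):=\sum_{n=0}^{\infty}a_m(k,n)x^n$. *)

theory Defs
  imports
    "HOL-Library.Multiset"
    "HOL-Computational_Algebra.Polynomial_FPS"
begin

definition power_partitions :: "nat \<Rightarrow> nat \<Rightarrow> nat \<Rightarrow> nat multiset set" where
  "power_partitions m k n =
     {M. size M = k \<and> sum_mset M = n \<and> (\<forall>p\<in>#M. \<exists>i. p = m ^ i)}"

definition a_count :: "nat \<Rightarrow> nat \<Rightarrow> nat \<Rightarrow> nat" where
  "a_count m k n = card (power_partitions m k n)"

definition A_fps :: "nat \<Rightarrow> nat \<Rightarrow> int fps" where
  "A_fps m k = Abs_fps (\<lambda>n. int (a_count m k n))"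

(* P_poly m k j is meaningful only for j <= k and is set to 0 otherwise.
   For m >= 1 the truncated subtractions in the exponents are exact. *)
fun P_poly :: "nat \<Rightarrow> nat \<Rightarrow> nat \<Rightarrow> int poly" where
  "P_poly m 0 j = (if j = 0 then 1 else 0)"
| "P_poly m (Suc k) j =
     (if j = 0 then monom 1 (m ^ k - 1) * P_poly m k 0
      else if j \<le> k then
        monom 1 (m ^ k - m ^ j) * P_poly m k j - monom 1 (m ^ k - m ^ (j - 1)) * P_poly m k (j - 1)
      else if j = Suc k then - P_poly m k k
      else 0)"

fun Q_poly :: "nat \<Rightarrow> nat \<Rightarrow> int poly" where
  "Q_poly m 0 = -1"
| "Q_poly m (Suc k) = monom 1 (m ^ k) * Q_poly m k"

end

theory Submission
  imports Defs "HOL-Computational_Algebra.Formal_Laurent_Series"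
begin

text \<open>
  A partition into \<open>k + 1\<close> powers of \<open>m\<close> either contains the part \<open>1\<close>, which can be removed, or
  has all parts divisible by \<open>m\<close>, so that it can be divided by \<open>m\<close>. Hence
  \<open>A(k + 1, x) - A(k + 1, x^m) = x A(k, x)\<close>. The recursion for \<open>P\<close> groups the terms of the
  sum for \<open>k + 1\<close> into multiples of these differences at \<open>x^(m^j)\<close>, which reduces that sum
  to \<open>x^(m^k)\<close> times the sum for \<open>k\<close>.
\<close>

text \<open>No part exceeds the sum \<open>n\<close>. Finiteness matters because \<open>card\<close>
  is 0 on infinite sets, so cardinalities could not be added.\<close>

lemma finite_power_partitions: "finite (power_partitions m k n)"
proof (rule finite_subset)
  have "set_mset M \<subseteq> {..n}" if "sum_mset M = n" for M :: "nat multiset"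
    using that by (auto dest: multi_member_split)
  then show "power_partitions m k n \<subseteq> multisets_of_size {..n} k"
    by (auto simp: power_partitions_def multisets_of_size_def)
qed auto

text \<open>The case \<open>n = 0\<close> is split off because \<open>n - 1\<close> would truncate
  to 0 and admit partitions of the wrong sum.\<close>

lemma power_partitions_with_one:
  "{M \<in> power_partitions m (Suc k) n. 1 \<in># M} =
    (if n = 0 then {} else add_mset 1 ` power_partitions m k (n - 1))"
proof (intro equalityI subsetI)
  fix M assume M: "M \<in> {M \<in> power_partitions m (Suc k) n. 1 \<in># M}"
  then obtain N where N: "M = add_mset 1 N"
    by (auto dest: multi_member_split)
  then have "n \<noteq> 0" "N \<in> power_partitions m k (n - 1)"
    using M by (auto simp: power_partitions_def)
  with N show "M \<in> (if n = 0 then {} else add_mset 1 ` power_partitions m k (n - 1))"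
    by simp
next
  fix M assume "M \<in> (if n = 0 then {} else add_mset 1 ` power_partitions m k (n - 1))"
  moreover have "\<exists>i. Suc 0 = m ^ i"
    by (rule exI[of _ 0]) simp
  ultimately show "M \<in> {M \<in> power_partitions m (Suc k) n. 1 \<in># M}"
    by (auto simp: power_partitions_def split: if_splits)
qed

lemma power_partitions_without_one:
  assumes "m \<ge> 2"
  shows "{M \<in> power_partitions m k n. 1 \<notin># M} =
    (if m dvd n then image_mset ((*) m) ` power_partitions m k (n div m) else {})"
proof (intro equalityI subsetI)
  fix M assume M: "M \<in> {M \<in> power_partitions m k n. 1 \<notin># M}"
  define N where "N = image_mset (\<lambda>p. p div m) M"
  have parts: "\<exists>i. p = m * m ^ i" if "p \<in># M" for p
  proof -
    obtain i where i: "p = m ^ i"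
      using M \<open>p \<in># M\<close> by (auto simp: power_partitions_def)
    with M \<open>p \<in># M\<close> have "i \<noteq> 0"
      by (cases i) auto
    with i show ?thesis
      by (metis not0_implies_Suc power_Suc)
  qed
  \<comment> \<open>The division is exact: by \<open>parts\<close>, every part is a multiple of
    \<open>m\<close>.\<close>
  have "image_mset (\<lambda>p. m * (p div m)) M = image_mset (\<lambda>p. p) M"
    by (rule image_mset_cong) (use parts assms in fastforce)
  then have MN: "M = image_mset ((*) m) N"
    by (simp add: N_def multiset.map_comp o_def)
  then have n: "n = m * sum_mset N"
    using M by (simp add: power_partitions_def sum_mset_distrib_left[of m "\<lambda>x. x", simplified])
  have "\<exists>i. q = m ^ i" if "q \<in># N" for q
    using that parts assms by (fastforce simp: N_def)
  then have "N \<in> power_partitions m k (n div m)"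
    using M n assms by (simp add: power_partitions_def N_def)
  with MN n show "M \<in> (if m dvd n then image_mset ((*) m) ` power_partitions m k (n div m) else {})"
    by simp
next
  fix M assume "M \<in> (if m dvd n then image_mset ((*) m) ` power_partitions m k (n div m) else {})"
  then obtain N where "m dvd n" and N: "N \<in> power_partitions m k (n div m)"
    and M: "M = image_mset ((*) m) N"
    by (auto split: if_splits)
  have "\<exists>i. p = m ^ i" if "p \<in># M" for p
    using that N unfolding M power_partitions_def by (fastforce intro: power_Suc[symmetric])
  moreover have "1 \<notin># M"
    using assms by (auto simp: M)
  ultimately show "M \<in> {M \<in> power_partitions m k n. 1 \<notin># M}"
    using N \<open>m dvd n\<close>
    by (auto simp: power_partitions_def M
        simp flip: sum_mset_distrib_left[of m "\<lambda>x. x", simplified])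
qed

text \<open>Splits the partitions by whether 1 is a part. At \<open>n = 0\<close> both sides contain
  the same count, so this serves as an identity between coefficients, not as a terminating
  recursion.\<close>

lemma a_count_Suc:
  assumes "m \<ge> 2"
  shows "a_count m (Suc k) n =
    (if n = 0 then 0 else a_count m k (n - 1)) +
    (if m dvd n then a_count m (Suc k) (n div m) else 0)"
proof -
  let ?S = "power_partitions m (Suc k) n"
  have "inj (image_mset ((*) m))"
    using assms by (intro multiset.inj_map) (simp add: inj_on_def)
  then have without_one: "card {M \<in> ?S. 1 \<notin># M} = (if m dvd n then a_count m (Suc k) (n div m) else 0)"
    unfolding power_partitions_without_one[OF assms] a_count_def
    by (simp add: card_image inj_on_subset[OF _ subset_UNIV])
  have with_one: "card {M \<in> ?S. 1 \<in># M} = (if n = 0 then 0 else a_count m k (n - 1))"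
    unfolding power_partitions_with_one a_count_def
    by (simp add: card_image inj_on_def)
  have "card ?S = card ({M \<in> ?S. 1 \<in># M} \<union> {M \<in> ?S. 1 \<notin># M})"
    by (rule arg_cong[of _ _ card]) blast
  also have "\<dots> = card {M \<in> ?S. 1 \<in># M} + card {M \<in> ?S. 1 \<notin># M}"
    by (rule card_Un_disjoint) (auto simp: finite_power_partitions)
  finally show ?thesis
    unfolding with_one without_one by (simp add: a_count_def)
qed

lemma A_fps_0: "A_fps m 0 = 1"
proof (rule fps_ext)
  fix n
  have "power_partitions m 0 n = (if n = 0 then {{#}} else {})"
    by (auto simp: power_partitions_def)
  then show "A_fps m 0 $ n = 1 $ n"
    by (simp add: A_fps_def a_count_def)
qed

lemma A_fps_Suc:
  assumes "m \<ge> 2"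
  shows "A_fps m (Suc k) - (A_fps m (Suc k) oo fps_X ^ m) = fps_X * A_fps m k"
proof (rule fps_ext)
  fix n
  show "(A_fps m (Suc k) - (A_fps m (Suc k) oo fps_X ^ m)) $ n = (fps_X * A_fps m k) $ n"
    \<comment> \<open>Substituting \<open>x^m\<close> moves coefficient \<open>n div m\<close> to
      \<open>n\<close> when \<open>m dvd n\<close> and leaves 0 elsewhere, which is the second
      summand of \<open>a_count_Suc\<close>.\<close>
    using assms a_count_Suc[OF assms, of k n] by (simp add: A_fps_def fps_nth_compose_X_power)
qed

text \<open>Substitutes \<open>x^(m^j)\<close> for \<open>x\<close> in \<open>A_fps_Suc\<close>. The
  inner series has constant term 0, so composition is associative and multiplicative.\<close>

lemma A_fps_Suc_dilated:
  assumes "m \<ge> 2"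
  shows "(A_fps m (Suc k) oo fps_X ^ (m ^ j)) - (A_fps m (Suc k) oo fps_X ^ (m ^ Suc j)) =
    fps_X ^ (m ^ j) * (A_fps m k oo fps_X ^ (m ^ j))"
proof -
  let ?A = "A_fps m (Suc k)" and ?Y = "fps_X ^ (m ^ j) :: int fps"
  have Y0: "?Y $ 0 = 0"
    using assms by simp
  have "?A oo fps_X ^ (m ^ Suc j) = (?A oo fps_X ^ m) oo ?Y"
    using assms by (simp add: fps_X_power_compose[OF Y0] mult.commute
        flip: fps_compose_assoc[OF Y0] power_mult)
  then have "(?A oo ?Y) - (?A oo fps_X ^ (m ^ Suc j)) = (?A - (?A oo fps_X ^ m)) oo ?Y"
    by (simp add: fps_compose_sub_distrib)
  then show ?thesis
    by (simp add: A_fps_Suc[OF assms] fps_compose_mult_distrib[OF Y0] fps_X_fps_compose_startby0[OF Y0])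
qed

text \<open>Summation by parts, valid for any sequence \<open>B\<close>: the new coefficients are
  the differences \<open>c j - c (j - 1)\<close>, with \<open>c\<close> read as 0 outside
  \<open>0..k\<close>.\<close>

lemma sum_P_poly_Suc:
  fixes B :: "nat \<Rightarrow> int fps"
  shows "(\<Sum>j=0..Suc k. fps_of_poly (P_poly m (Suc k) j) * B j) =
    (\<Sum>j=0..k. fps_X ^ (m ^ k - m ^ j) * fps_of_poly (P_poly m k j) * (B j - B (Suc j)))"
proof -
  define c where "c j = fps_X ^ (m ^ k - m ^ j) * fps_of_poly (P_poly m k j)" for j
  \<comment> \<open>The boundary clauses of the recursion fit the same pattern: \<open>c 0\<close>
    has exponent \<open>m ^ k - 1\<close>, and \<open>c k\<close> has exponent 0, which gives
    \<open>- P_poly m k k\<close> at \<open>j = Suc k\<close>.\<close>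
  have P: "fps_of_poly (P_poly m (Suc k) j) =
      (if j \<le> k then c j else 0) - (if j = 0 then 0 else c (j - 1))" if "j \<le> Suc k" for j
    using that by (auto simp: c_def fps_of_poly_mult fps_of_poly_diff fps_of_poly_uminus
        fps_of_poly_monom le_Suc_eq)
  have "(\<Sum>j=0..Suc k. fps_of_poly (P_poly m (Suc k) j) * B j) =
      (\<Sum>j=0..Suc k. (if j \<le> k then c j else 0) * B j) -
      (\<Sum>j=0..Suc k. (if j = 0 then 0 else c (j - 1)) * B j)"
    unfolding sum_subtractf[symmetric]
    by (intro sum.cong refl) (simp add: P left_diff_distrib del: P_poly.simps)
  also have "(\<Sum>j=0..Suc k. (if j = 0 then 0 else c (j - 1)) * B j) = (\<Sum>j=0..k. c j * B (Suc j))"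
    by (subst sum.atLeast0_atMost_Suc_shift) simp
  also have "(\<Sum>j=0..Suc k. (if j \<le> k then c j else 0) * B j) = (\<Sum>j=0..k. c j * B j)"
    by simp
  finally show ?thesis
    by (simp add: c_def sum_subtractf right_diff_distrib)
qed

lemma sum_P_poly_A_fps:
  assumes "m \<ge> 2"
  shows "(\<Sum>j=0..k. fps_of_poly (P_poly m k j) * (A_fps m k oo fps_X ^ (m ^ j))) =
    - fps_of_poly (Q_poly m k)"
proof (induction k)
  case 0
  \<comment> \<open>Only the empty partition has no parts, so the sum is 1, matching
    \<open>Q_poly m 0 = -1\<close>.\<close>
  show ?case
    by (simp add: A_fps_0)
next
  case (Suc k)
  have "(\<Sum>j=0..Suc k. fps_of_poly (P_poly m (Suc k) j) * (A_fps m (Suc k) oo fps_X ^ (m ^ j))) =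
      (\<Sum>j=0..k. fps_X ^ (m ^ k - m ^ j) * fps_of_poly (P_poly m k j) *
        (fps_X ^ (m ^ j) * (A_fps m k oo fps_X ^ (m ^ j))))"
    unfolding sum_P_poly_Suc A_fps_Suc_dilated[OF assms] ..
  also have "\<dots> = (\<Sum>j=0..k. fps_X ^ (m ^ k) *
      (fps_of_poly (P_poly m k j) * (A_fps m k oo fps_X ^ (m ^ j))))"
  proof (intro sum.cong refl)
    fix j assume "j \<in> {0..k}"
    \<comment> \<open>This makes the truncated exponent \<open>m ^ k - m ^ j\<close> exact, so the
      two powers of \<open>x\<close> combine to \<open>x^(m^k)\<close> independently of
      \<open>j\<close>.\<close>
    then have "m ^ j \<le> m ^ k"
      using assms by (intro power_increasing) auto
    then have "fps_X ^ (m ^ k) = (fps_X ^ (m ^ k - m ^ j) * fps_X ^ (m ^ j) :: int fps)"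
      by (simp flip: power_add)
    then show "fps_X ^ (m ^ k - m ^ j) * fps_of_poly (P_poly m k j) *
        (fps_X ^ (m ^ j) * (A_fps m k oo fps_X ^ (m ^ j))) =
      fps_X ^ (m ^ k) * (fps_of_poly (P_poly m k j) * (A_fps m k oo fps_X ^ (m ^ j)))"
      by (simp only: mult_ac)
  qed
  \<comment> \<open>The common factor comes out of the sum and is the one by which
    \<open>Q_poly\<close> grows from \<open>k\<close> to \<open>Suc k\<close>.\<close>
  also have "\<dots> = fps_X ^ (m ^ k) * - fps_of_poly (Q_poly m k)"
    unfolding sum_distrib_left[symmetric] Suc.IH ..
  finally show ?case
    by (simp add: fps_of_poly_mult fps_of_poly_monom)
qed

theorem theorem6p5:
  fixes m k :: nat
  assumes "m \<ge> 2" and "k \<ge> 1"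
  shows "(\<Sum>j=0..k. fps_of_poly (P_poly m k j) * (A_fps m k oo fps_X ^ (m ^ j))) + fps_of_poly (Q_poly m k) = 0"
  using sum_P_poly_A_fps[OF assms(1), of k] by simp

end
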